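(* Consider a TV-ARMA($p,q$) model with deterministic coefficients, $\Phi_t(B)y_t=\varphi(t)+\Theta_t(B)\varepsilon_t$, $t\in\mathbb{Z}$. Under the absolute summability condition $\sum_{r=-\infty}^{t}|\xi(t,r)|<\infty$ for all $t$, the Wold-Cramér operators are given by $$\Xi_t(B)=\Phi_t^{-1}(B)\quad\text{and}\quad \Xi_{t,q}(B)=\Phi_t^{-1}(B)\circ\Theta_t(B)\quad\text{with respect to }\circ .$$ The Wold-Cramér decomposition $y_t=\sum_{r=-\infty}^{t}\xi(t,r)\varphi(r)+\sum_{r=-\infty}^{t}\xi_q(t,r)\varepsilon_r$ (valid when in addition $\varphi(t)$ and $\theta_l(t)$, $1\le l\le q$, are bounded in $t$) can be written in terms of the Wold-Cramér operators as $$y_t=\Xi_t(B)\circ\varphi(t)+\Xi_{t,q}(B)\varepsilon_t,$$ which implies $\mathbb{E}(y_t)=\Xi_t(B)\circ\varphi(t)$.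
   Context: Let $p,q\ge1$ be integers; $\varphi(t),\phi_m(t),\theta_l(t)$ are deterministic real-valued functions of $t\in\mathbb{Z}$. $B$ is the backshift operator, $By_t=y_{t-1}$, and $\Phi_t(B)=1-\sum_{m=1}^{p}\phi_m(t)B^m$, $\Theta_t(B)=1+\sum_{l=1}^{q}\theta_l(t)B^l$. The errors satisfy $\mathbb{E}(\varepsilon_t)=0$, $\mathbb{E}(\varepsilon_t\varepsilon_s)=0$ for $s\ne t$, $\mathbb{E}(\varepsilon_t\mid y_s,s<t)=0$, $\mathbb{E}(\varepsilon_t^2)=\sigma^2(t)$, $0<\sigma^2(t)\le M<\infty$. The skew multiplication $\circ$ is the associative noncommutative product on (possibly infinite order) operators $\sum_r a_r(t)B^r$ determined by $B^i\circ B^j=B^{i+j}$ and $B^i\circ f(t)=f(t-i)B^i$ for a function $f$ of time. $\Phi_t^{-1}(B)$ denotes the inverse with respect to $\circ$, i.e. $\Phi_t^{-1}(B)\circ\Phi_t(B)=1$. For a sequence $f(t)$, the expression $\big(\sum_r a_r(t)B^r\big)\circ f(t)$ in the displayed representation of $y_t$ stands for $\sum_r a_r(t)f(t-r)$. For $s<t$, $\xi(t,s)=\det(\mathbf{\Phi}_{t,s})$, where $\mathbf{\Phi}_{t,s}$ is the $(t-s)\times(t-s)$ matrix whose $(i,j)$ entry is $\phi_{i-j+1}(s+i)$ if $0\le i-j\le p-1$, $-1$ if $j=i+1$, and $0$ otherwise; $\xi(t,t)=1$, $\xi(t,s)=0$ for $t<s$. Also $\xi_q(t,r)=\xi(t,r)+\sum_{l=1}^{q}\xi(t,r+l)\theta_l(r+l)$.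 The Wold-Cramér operators are $\Xi_t(B)=\sum_{r=0}^{\infty}\xi(t,t-r)B^r$ and $\Xi_{t,q}(B)=\sum_{r=0}^{\infty}\xi_q(t,t-r)B^r$.
   Formalization: Solutions of the model are not unique (one can add 2^{-t} when phi_1=1/2), so the operator form and mean are proved for y_t given a.s. by the decomposition, which holds iff the part of y_t from initial values at time s tends to 0 in probability as s tends to minus infinity. *)

theory Defs
  imports
    "HOL-Probability.Probability"
    "HOL-Computational_Algebra.Formal_Power_Series"
    "Jordan_Normal_Form.Determinant"
begin

section \<open>Skew operators\<close>

text \<open>An operator \<open>A\<close> stands for the formal series in the backshift with coefficients on the
  left: \<open>A r t\<close> is the value at time \<open>t\<close> of the coefficient of the \<open>r\<close>-th power of the backshift.\<close>

type_synonym skew_op = "nat \<Rightarrow> int \<Rightarrow> real"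

definition skew_monom :: "(int \<Rightarrow> real) \<Rightarrow> nat \<Rightarrow> skew_op" where
  "skew_monom f i = (\<lambda>r t. if r = i then f t else 0)"

definition skew_one :: skew_op where
  "skew_one = skew_monom (\<lambda>_. 1) 0"

text \<open>Moving the \<open>i\<close>-th power of the backshift to the right past a coefficient delays that
  coefficient by \<open>i\<close>; this gives the argument \<open>t - i\<close> of the second factor.\<close>

definition skew_mult :: "skew_op \<Rightarrow> skew_op \<Rightarrow> skew_op" (infixl \<open>\<circ>\<^sub>s\<close> 70) where
  "A \<circ>\<^sub>s C = (\<lambda>n t. \<Sum>i=0..n. A i t * C (n - i) (t - int i))"

lemma skew_mult_monom:
  "skew_monom f i \<circ>\<^sub>s skew_monom g j = skew_monom (\<lambda>t. f t * g (t - int i)) (i + j)"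
proof (intro ext)
  fix n :: nat and t :: int
  have "(skew_monom f i \<circ>\<^sub>s skew_monom g j) n t
      = (\<Sum>k=0..n. if k = i then (if n - i = j then f t * g (t - int i) else 0) else 0)"
    unfolding skew_mult_def skew_monom_def by (intro sum.cong) auto
  also have "\<dots> = skew_monom (\<lambda>t. f t * g (t - int i)) (i + j) n t"
    by (auto simp: skew_monom_def)
  finally show "(skew_monom f i \<circ>\<^sub>s skew_monom g j) n t
      = skew_monom (\<lambda>t. f t * g (t - int i)) (i + j) n t" .
qed

lemma skew_mult_assoc: "(A \<circ>\<^sub>s C) \<circ>\<^sub>s D = A \<circ>\<^sub>s (C \<circ>\<^sub>s D)"
proof (intro ext)
  fix n :: nat and t :: int
  have "((A \<circ>\<^sub>s C) \<circ>\<^sub>s D) n t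
      = (\<Sum>i=0..n. \<Sum>j=0..i. A j t * C (i - j) (t - int j) * D (n - i) (t - int (j + (i - j))))"
    unfolding skew_mult_def sum_distrib_right by (intro sum.cong) auto
  also have "\<dots> = (\<Sum>j=0..n. \<Sum>i=0..n-j. A j t * C i (t - int j) * D (n - j - i) (t - int (j + i)))"
    by (rule fps_mult_assoc_lemma[where f = "\<lambda>j i k. A j t * C i (t - int j) * D k (t - int (j + i))"])
  also have "\<dots> = (A \<circ>\<^sub>s (C \<circ>\<^sub>s D)) n t"
    unfolding skew_mult_def sum_distrib_left
    by (intro sum.cong) (auto simp: algebra_simps)
  finally show "((A \<circ>\<^sub>s C) \<circ>\<^sub>s D) n t = (A \<circ>\<^sub>s (C \<circ>\<^sub>s D)) n t" .
qed

definition skew_inverse :: "skew_op \<Rightarrow> skew_op" where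
  "skew_inverse A = (THE C. C \<circ>\<^sub>s A = skew_one)"

definition skew_apply :: "skew_op \<Rightarrow> (int \<Rightarrow> real) \<Rightarrow> int \<Rightarrow> real" where
  "skew_apply A f t = (\<Sum>\<^sub>\<infinity>r. A r t * f (t - int r))"


section \<open>Autoregressive and moving average operators\<close>

definition Phi_op :: "nat \<Rightarrow> (nat \<Rightarrow> int \<Rightarrow> real) \<Rightarrow> skew_op" where
  "Phi_op p phi = (\<lambda>r t. if r = 0 then 1 else if r \<le> p then - phi r t else 0)"

definition Theta_op :: "nat \<Rightarrow> (nat \<Rightarrow> int \<Rightarrow> real) \<Rightarrow> skew_op" where
  "Theta_op q theta = (\<lambda>r t. if r = 0 then 1 else if r \<le> q then theta r t else 0)"


section \<open>The principal determinant and the Wold-Cramer operators\<close>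

text \<open>Matrix indices start at \<open>0\<close>, so the entry at \<open>(i, j)\<close> below is the usual entry at
  \<open>(i + 1, j + 1)\<close>; this accounts for the time index \<open>s + i + 1\<close>.\<close>

definition Phi_mat :: "nat \<Rightarrow> (nat \<Rightarrow> int \<Rightarrow> real) \<Rightarrow> int \<Rightarrow> int \<Rightarrow> real mat" where
  "Phi_mat p phi t s = mat (nat (t - s)) (nat (t - s)) (\<lambda>(i, j).
     if j \<le> i \<and> i - j \<le> p - 1 then phi (i - j + 1) (s + int i + 1)
     else if j = i + 1 then - 1 else 0)"

definition xi :: "nat \<Rightarrow> (nat \<Rightarrow> int \<Rightarrow> real) \<Rightarrow> int \<Rightarrow> int \<Rightarrow> real" where
  "xi p phi t s = (if s < t then Determinant.det (Phi_mat p phi t s) else if s = t then 1 else 0)"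

definition xi_q :: "nat \<Rightarrow> nat \<Rightarrow> (nat \<Rightarrow> int \<Rightarrow> real) \<Rightarrow> (nat \<Rightarrow> int \<Rightarrow> real) \<Rightarrow> int \<Rightarrow> int \<Rightarrow> real" where
  "xi_q p q phi theta t r =
     xi p phi t r + (\<Sum>l=1..q. xi p phi t (r + int l) * theta l (r + int l))"

definition Xi_op :: "nat \<Rightarrow> (nat \<Rightarrow> int \<Rightarrow> real) \<Rightarrow> skew_op" where
  "Xi_op p phi = (\<lambda>r t. xi p phi t (t - int r))"

definition Xi_q_op :: "nat \<Rightarrow> nat \<Rightarrow> (nat \<Rightarrow> int \<Rightarrow> real) \<Rightarrow> (nat \<Rightarrow> int \<Rightarrow> real) \<Rightarrow> skew_op" where
  "Xi_q_op p q phi theta = (\<lambda>r t. xi_q p q phi theta t (t - int r))"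


section \<open>The model\<close>

definition past_sigma :: "'w measure \<Rightarrow> (int \<Rightarrow> 'w \<Rightarrow> real) \<Rightarrow> int \<Rightarrow> 'w measure" where
  "past_sigma M y t = sigma (space M) {y s -` A \<inter> space M | s A. s < t \<and> A \<in> sets borel}"

locale tv_arma = prob_space M
  for M :: "'w measure"
    and p q :: nat
    and varphi :: "int \<Rightarrow> real"
    and phi theta :: "nat \<Rightarrow> int \<Rightarrow> real"
    and sigma2 :: "int \<Rightarrow> real"
    and eps y :: "int \<Rightarrow> 'w \<Rightarrow> real" +
  assumes p_ge_1: "1 \<le> p" and q_ge_1: "1 \<le> q"
    and y_measurable: "\<And>t. y t \<in> borel_measurable M"
    and eps_measurable: "\<And>t. eps t \<in> borel_measurable M"
    and eps_square_integrable: "\<And>t. integrable M (\<lambda>\<omega>. (eps t \<omega>)\<^sup>2)"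
    and eps_mean: "\<And>t. expectation (eps t) = 0"
    and eps_uncorrelated: "\<And>t s. s \<noteq> t \<Longrightarrow> expectation (\<lambda>\<omega>. eps t \<omega> * eps s \<omega>) = 0"
    and eps_cond_mean: "\<And>t. AE \<omega> in M. real_cond_exp M (past_sigma M y t) (eps t) \<omega> = 0"
    and eps_variance: "\<And>t. expectation (\<lambda>\<omega>. (eps t \<omega>)\<^sup>2) = sigma2 t"
    and sigma2_pos: "\<And>t. 0 < sigma2 t"
    and sigma2_bounded: "\<exists>C. \<forall>t. sigma2 t \<le> C"
    and model: "\<And>t. AE \<omega> in M. skew_apply (Phi_op p phi) (\<lambda>s. y s \<omega>) t
                   = varphi t + skew_apply (Theta_op q theta) (\<lambda>s. eps s \<omega>) t"


section \<open>The Wold-Cramer decomposition\<close>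

definition wold_cramer_det ::
  "nat \<Rightarrow> (int \<Rightarrow> real) \<Rightarrow> (nat \<Rightarrow> int \<Rightarrow> real) \<Rightarrow> int \<Rightarrow> real" where
  "wold_cramer_det p varphi phi t = (\<Sum>\<^sub>\<infinity>r\<in>{..t}. xi p phi t r * varphi r)"

definition wold_cramer_stoch ::
  "nat \<Rightarrow> nat \<Rightarrow> (nat \<Rightarrow> int \<Rightarrow> real) \<Rightarrow> (nat \<Rightarrow> int \<Rightarrow> real) \<Rightarrow> (int \<Rightarrow> 'w \<Rightarrow> real)
    \<Rightarrow> int \<Rightarrow> 'w \<Rightarrow> real" where
  "wold_cramer_stoch p q phi theta eps t \<omega> = (\<Sum>\<^sub>\<infinity>r\<in>{..t}. xi_q p q phi theta t r * eps r \<omega>)"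

definition wold_cramer ::
  "nat \<Rightarrow> nat \<Rightarrow> (int \<Rightarrow> real) \<Rightarrow> (nat \<Rightarrow> int \<Rightarrow> real) \<Rightarrow> (nat \<Rightarrow> int \<Rightarrow> real)
    \<Rightarrow> (int \<Rightarrow> 'w \<Rightarrow> real) \<Rightarrow> int \<Rightarrow> 'w \<Rightarrow> real" where
  "wold_cramer p q varphi phi theta eps t \<omega> =
     wold_cramer_det p varphi phi t + wold_cramer_stoch p q phi theta eps t \<omega>"

text \<open>Multiplying the model equation at the times \<open>r\<close> with \<open>s < r \<le> t\<close> by \<open>xi p phi t r\<close> and adding
  up eliminates \<open>y r\<close> for \<open>s < r < t\<close>. What remains, besides \<open>y t\<close> and the forcing terms, is the
  following combination of the \<open>p\<close> initial values \<open>y s, \<dots>, y (s + 1 - p)\<close>: the solution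
  of the homogeneous equation with these initial values. A process solving the model is given by
  its forcing terms alone exactly when this part dies out as \<open>s\<close> tends to minus infinity.\<close>

definition homogeneous_part ::
  "nat \<Rightarrow> (nat \<Rightarrow> int \<Rightarrow> real) \<Rightarrow> (int \<Rightarrow> 'w \<Rightarrow> real) \<Rightarrow> int \<Rightarrow> int \<Rightarrow> 'w \<Rightarrow> real" where
  "homogeneous_part p phi y t s \<omega> =
     (\<Sum>m=1..p. (\<Sum>r=1..p+1-m. phi (m - 1 + r) (s + int r) * xi p phi t (s + int r))
        * y (s + 1 - int m) \<omega>)"

end

theory Submission
  imports Defs
begin

text \<open>
  The principal determinants are determinants of Hessenberg matrices, and multiplying such a matrix
  by a unipotent matrix that clears all but one entry of its first column shows that they satisfy
  the recursion \<open>Phi \<circ> Xi = 1\<close>. As the constant coefficient of \<open>Phi\<close> is \<open>1\<close>, a left inverse of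
  \<open>Phi\<close> exists, so \<open>Xi\<close> is the two-sided inverse.

  If \<open>c\<close> is absolutely summable and the second moments of \<open>e\<close> are at most \<open>C\<close>, then
  \<open>(\<Sum> c n e n)\<^sup>2 \<le> (\<Sum> \<bar>c n\<bar>) (\<Sum> \<bar>c n\<bar> (e n)\<^sup>2)\<close> gives almost sure absolute convergence of
  \<open>\<Sum> c n e n\<close> and the bound \<open>C (\<Sum> \<bar>c n\<bar>)\<^sup>2\<close> for its second moment. Absolute convergence makes
  the action of skew operators on sequences associative, so \<open>Phi (Xi varphi + (Xi \<circ> Theta) eps) = varphi + Theta eps\<close>.
  Finally \<open>y t\<close> minus the homogeneous part at \<open>s\<close> is a partial sum of the almost surely convergent
  series \<open>Xi (varphi + Theta eps)\<close>, which is the decomposition, so the homogeneous part converges almost surely to the difference of \<open>y t\<close> and the decomposition;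
  hence it tends to \<open>0\<close> in probability iff this difference vanishes almost surely.
\<close>

section \<open>Inverse of the autoregressive operator\<close>

text \<open>The recursion for \<open>x\<close> solves the rows of \<open>H x = 0\<close> above the
  last one from the top, the superdiagonal \<open>- 1\<close> yielding \<open>x (Suc i)\<close>.
  With \<open>x\<close> as the first column of a unipotent \<open>U\<close>, the first column of
  \<open>H * U\<close> keeps only its bottom entry.\<close>

lemma det_hessenberg:
  fixes H :: "'a :: comm_ring_1 mat"
  assumes H: "H \<in> carrier_mat (Suc m) (Suc m)"
    and superdiag: "\<And>i. i < m \<Longrightarrow> H $$ (i, Suc i) = - 1"
    and above: "\<And>i j. j \<le> m \<Longrightarrow> Suc i < j \<Longrightarrow> H $$ (i, j) = 0"
    and x0: "x 0 = 1"
    and x: "\<And>i. i < m \<Longrightarrow> x (Suc i) = (\<Sum>j\<le>i. H $$ (i, j) * x j)"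
  shows "Determinant.det H = (\<Sum>j\<le>m. H $$ (m, j) * x j)"
proof -
  define U where "U = mat (Suc m) (Suc m) (\<lambda>(i, j). if j = 0 then x i else if i = j then 1 else 0)"
  have U: "U \<in> carrier_mat (Suc m) (Suc m)" by (simp add: U_def)
  have "Determinant.det U = prod_list (diag_mat U)"
    by (rule det_lower_triangular[OF _ U]) (auto simp: U_def)
  also have "\<dots> = 1"
    unfolding prod_list_diag_prod by (rule prod.neutral) (auto simp: U_def x0)
  finally have detU: "Determinant.det U = 1" .
  define K where "K = H * U"
  have K: "K \<in> carrier_mat (Suc m) (Suc m)" using H U by (simp add: K_def)
  have K_eq: "K $$ (i, j) = (\<Sum>k\<le>m. H $$ (i, k) * U $$ (k, j))" if "i \<le> m" "j \<le> m" for i j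
    using that H U
    by (simp add: K_def scalar_prod_def lessThan_Suc_atMost atLeast0LessThan)
  have K0: "K $$ (i, 0) = 0" if "i < m" for i
  proof -
    have "K $$ (i, 0) = (\<Sum>k\<le>m. H $$ (i, k) * x k)"
      using that by (subst K_eq) (auto simp: U_def)
    \<comment> \<open>Row \<open>i\<close> ends at column \<open>Suc i\<close>, where the entry
      \<open>- 1\<close> contributes \<open>- x (Suc i)\<close> and cancels the other terms.\<close>
    also have "\<dots> = (\<Sum>k\<le>Suc i. H $$ (i, k) * x k)"
      using that above by (intro sum.mono_neutral_right) auto
    also have "\<dots> = 0" using that by (simp add: superdiag x)
    finally show ?thesis .
  qed
  have Km: "K $$ (m, 0) = (\<Sum>j\<le>m. H $$ (m, j) * x j)"
    by (subst K_eq) (auto simp: U_def)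
  have Kj: "K $$ (i, j) = H $$ (i, j)" if "i \<le> m" "j \<le> m" "0 < j" for i j
  proof -
    have "K $$ (i, j) = (\<Sum>k\<le>m. if k = j then H $$ (i, k) else 0)"
      unfolding K_eq[OF that(1,2)] using that by (intro sum.cong) (auto simp: U_def)
    then show ?thesis using that by simp
  qed
  \<comment> \<open>Without last row and first column the matrix is lower triangular, with the
    superdiagonal of \<open>H\<close> as its diagonal.\<close>
  define D where "D = mat_delete K m 0"
  have D: "D \<in> carrier_mat m m" using mat_delete_carrier[OF K] by (simp add: D_def)
  have D_eq: "D $$ (i, j) = H $$ (i, Suc j)" if "i < m" "j < m" for i j
    using that K Kj[of i "Suc j"] by (simp add: D_def mat_delete_def)
  have "Determinant.det D = prod_list (diag_mat D)"
    by (rule det_lower_triangular[OF _ D]) (simp add: D_eq above)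
  also have "\<dots> = (\<Prod>i<m. - 1)"
    unfolding prod_list_diag_prod using D
    by (auto simp: D_eq superdiag atLeast0LessThan intro!: prod.cong)
  finally have detD: "Determinant.det D = (- 1) ^ m" by simp
  have "Determinant.det H = Determinant.det K"
    by (simp add: K_def det_mult[OF H U] detU)
  also have "\<dots> = (\<Sum>i<Suc m. K $$ (i, 0) * cofactor K i 0)"
    by (rule laplace_expansion_column[OF K]) simp
  also have "\<dots> = K $$ (m, 0) * cofactor K m 0"
    by (simp add: K0)
  \<comment> \<open>The sign \<open>(- 1) ^ m\<close> of the cofactor cancels the determinant of
    \<open>D\<close>.\<close>
  also have "cofactor K m 0 = 1"
    using detD by (simp add: cofactor_def D_def flip: power_add mult_2)
  finally show ?thesis by (simp add: Km)
qed

section \<open>One-sided and two-sided inverses for the skew product\<close>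

lemma skew_one_mult [simp]: "skew_one \<circ>\<^sub>s A = A"
proof (intro ext)
  fix n t
  have "(skew_one \<circ>\<^sub>s A) n t = (\<Sum>i=0..n. if i = 0 then A n t else 0)"
    unfolding skew_mult_def skew_one_def skew_monom_def by (intro sum.cong) auto
  then show "(skew_one \<circ>\<^sub>s A) n t = A n t" by simp
qed

lemma skew_mult_one [simp]: "A \<circ>\<^sub>s skew_one = A"
proof (intro ext)
  fix n t
  have "(A \<circ>\<^sub>s skew_one) n t = (\<Sum>i=0..n. if i = n then A n t else 0)"
    unfolding skew_mult_def skew_one_def skew_monom_def by (intro sum.cong) auto
  then show "(A \<circ>\<^sub>s skew_one) n t = A n t" by simp
qed

context
  notes sum.cong [fundef_cong]
begin

text \<open>Comparing coefficients in \<open>C \<circ>\<^sub>s A = skew_one\<close> when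
  \<open>A 0\<close> is constantly \<open>1\<close>, and solving for the coefficient of index
  \<open>n\<close>. The local congruence rule hands \<open>i < n\<close> to the termination
  proof.\<close>

fun left_inv_coeff :: "skew_op \<Rightarrow> skew_op" where
  "left_inv_coeff A n t =
     (if n = 0 then 1 else - (\<Sum>i<n. left_inv_coeff A i t * A (n - i) (t - int i)))"

end

declare left_inv_coeff.simps [simp del]

lemma left_inv_coeff:
  assumes "A 0 = (\<lambda>_. 1)"
  shows "left_inv_coeff A \<circ>\<^sub>s A = skew_one"
proof (intro ext)
  fix n t
  show "(left_inv_coeff A \<circ>\<^sub>s A) n t = skew_one n t"
    using assms left_inv_coeff.simps[of A n t]
    by (simp add: skew_mult_def skew_one_def skew_monom_def atLeast0AtMost
        flip: lessThan_Suc_atMost split: if_splits)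
qed

text \<open>The usual monoid argument: the left inverse built recursively must coincide with the
  given right inverse.\<close>

lemma skew_right_inverse_imp_left_inverse:
  assumes "A 0 = (\<lambda>_. 1)" and "A \<circ>\<^sub>s C = skew_one"
  shows "C \<circ>\<^sub>s A = skew_one"
proof -
  have "left_inv_coeff A = left_inv_coeff A \<circ>\<^sub>s (A \<circ>\<^sub>s C)" by (simp add: assms)
  also have "\<dots> = C" by (simp add: left_inv_coeff[of A] assms(1) flip: skew_mult_assoc)
  finally show ?thesis using left_inv_coeff[of A] assms(1) by simp
qed

text \<open>\<open>skew_inverse\<close> is a definite description of a left inverse; the right
  inverse property of \<open>C\<close> makes that left inverse unique.\<close>

lemma skew_inverse_eqI:
  assumes "A \<circ>\<^sub>s C = skew_one" and "C \<circ>\<^sub>s A = skew_one"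
  shows "skew_inverse A = C"
  unfolding skew_inverse_def
proof (rule the_equality)
  fix D assume "D \<circ>\<^sub>s A = skew_one"
  then have "C = (D \<circ>\<^sub>s A) \<circ>\<^sub>s C" by simp
  also have "\<dots> = D" by (simp add: skew_mult_assoc assms)
  finally show "D = C" by simp
qed (rule assms)

text \<open>As a function of its first argument, \<open>xi\<close> solves the homogeneous
  autoregressive equation. Row \<open>i\<close> of the matrix depends on \<open>s\<close> and
  \<open>i\<close> but, up to its length, not on \<open>t\<close>, so the induction hypothesis at
  \<open>s + i + 1\<close> is the recursion that \<open>det_hessenberg\<close> asks of
  \<open>x j = xi p phi (s + j) s\<close>.\<close>

lemma xi_row_recursion:
  assumes "1 \<le> p" and "s < t"
  shows "xi p phi t s = (\<Sum>j<nat (t - s).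
           (if nat (t - s) - j \<le> p then phi (nat (t - s) - j) t else 0) * xi p phi (s + int j) s)"
  using \<open>s < t\<close>
proof (induction "nat (t - s)" arbitrary: t rule: less_induct)
  case (less t)
  define m where "m = nat (t - s) - 1"
  have t: "t = s + 1 + int m" and n: "nat (t - s) = Suc m" using less.prems by (auto simp: m_def)
  define H where "H = Phi_mat p phi t s"
  have H_eq: "H $$ (i, j) = (if i - j \<le> p - 1 then phi (i - j + 1) (s + int i + 1) else 0)"
    if "j \<le> i" "i \<le> m" for i j
    using that by (simp add: H_def Phi_mat_def n)
  \<comment> \<open>Since \<open>1 \<le> p\<close>, the truncated \<open>p - 1\<close> is the true
    difference, and the condition on the lag \<open>Suc i - j\<close> becomes a comparison with
    \<open>p\<close>.\<close>
  have H_eq': "H $$ (i, j) = (if Suc i - j \<le> p then phi (Suc i - j) (s + int (Suc i)) else 0)"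
    if "j \<le> i" "i \<le> m" for i j
    using that \<open>1 \<le> p\<close> by (auto simp: H_eq Suc_diff_le algebra_simps)
  have "xi p phi t s = Determinant.det H" using less.prems by (simp add: xi_def H_def)
  also have "\<dots> = (\<Sum>j\<le>m. H $$ (m, j) * xi p phi (s + int j) s)"
  proof (rule det_hessenberg)
    show "xi p phi (s + int (Suc i)) s = (\<Sum>j\<le>i. H $$ (i, j) * xi p phi (s + int j) s)"
      if "i < m" for i
    proof -
      have nk: "nat (s + int (Suc i) - s) = Suc i" by simp
      have "xi p phi (s + int (Suc i)) s = (\<Sum>j<Suc i.
           (if Suc i - j \<le> p then phi (Suc i - j) (s + int (Suc i)) else 0) * xi p phi (s + int j) s)"
        by (rule less.hyps[of "s + int (Suc i)", unfolded nk n]) (use that in auto)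
      also have "\<dots> = (\<Sum>j\<le>i. H $$ (i, j) * xi p phi (s + int j) s)"
        using that unfolding lessThan_Suc_atMost by (intro sum.cong) (auto simp: H_eq')
      finally show ?thesis .
    qed
  qed (auto simp: H_def Phi_mat_def n xi_def)
  also have "\<dots> = (\<Sum>j<nat (t - s).
           (if nat (t - s) - j \<le> p then phi (nat (t - s) - j) t else 0) * xi p phi (s + int j) s)"
    unfolding n lessThan_Suc_atMost
    by (intro sum.cong) (auto simp: H_eq' t algebra_simps)
  finally show ?case .
qed

text \<open>For \<open>n > 0\<close> the \<open>n\<close>-th coefficient is the difference of the
  two sides of \<open>xi_row_recursion\<close> with \<open>s = t - n\<close>.\<close>

lemma Phi_op_mult_Xi_op:
  assumes "1 \<le> p"
  shows "Phi_op p phi \<circ>\<^sub>s Xi_op p phi = skew_one"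
proof (intro ext)
  fix n t
  show "(Phi_op p phi \<circ>\<^sub>s Xi_op p phi) n t = skew_one n t"
  proof (cases "n = 0")
    case True
    then show ?thesis
      by (simp add: skew_mult_def Phi_op_def Xi_op_def xi_def skew_one_def skew_monom_def)
  next
    case False
    have "(Phi_op p phi \<circ>\<^sub>s Xi_op p phi) n t
        = (\<Sum>i\<le>n. Phi_op p phi i t * xi p phi (t - int i) (t - int n))"
      unfolding skew_mult_def Xi_op_def atLeast0AtMost
      by (intro sum.cong) (auto simp: algebra_simps of_nat_diff)
    also have "\<dots> = (\<Sum>j\<le>n. Phi_op p phi (n - j) t * xi p phi (t - int n + int j) (t - int n))"
      by (rule sum.reindex_bij_witness[of _ "\<lambda>i. n - i" "\<lambda>i. n - i"])
        (auto simp: of_nat_diff algebra_simps)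
    also have "\<dots> = xi p phi t (t - int n)
        + (\<Sum>j<n. Phi_op p phi (n - j) t * xi p phi (t - int n + int j) (t - int n))"
      by (simp add: Phi_op_def flip: lessThan_Suc_atMost)
    also have "(\<Sum>j<n. Phi_op p phi (n - j) t * xi p phi (t - int n + int j) (t - int n))
        = - xi p phi t (t - int n)"
      using False
      by (subst xi_row_recursion[OF assms])
        (auto simp: Phi_op_def sum_negf[symmetric] intro!: sum.cong)
    finally show ?thesis using False by (simp add: skew_one_def skew_monom_def)
  qed
qed

text \<open>This is the recursion in the second argument of \<open>xi\<close>, obtained from algebra
  in place of a second determinant expansion.\<close>

lemma Xi_op_mult_Phi_op:
  assumes "1 \<le> p"
  shows "Xi_op p phi \<circ>\<^sub>s Phi_op p phi = skew_one"
  by (rule skew_right_inverse_imp_left_inverse[OF _ Phi_op_mult_Xi_op[OF assms]])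
    (simp add: Phi_op_def)

lemma Xi_q_op_eq: "Xi_q_op p q phi theta = Xi_op p phi \<circ>\<^sub>s Theta_op q theta"
proof (intro ext)
  fix n t
  have "(Xi_op p phi \<circ>\<^sub>s Theta_op q theta) n t
      = (\<Sum>l\<le>n. xi p phi t (t - int n + int l) * Theta_op q theta l (t - int n + int l))"
    unfolding skew_mult_def Xi_op_def
    by (rule sum.reindex_bij_witness[of _ "\<lambda>i. n - i" "\<lambda>i. n - i"])
      (auto simp: of_nat_diff algebra_simps)
  also have "\<dots> = xi p phi t (t - int n)
      + (\<Sum>l\<in>{1..n}. xi p phi t (t - int n + int l) * Theta_op q theta l (t - int n + int l))"
    by (simp add: Theta_op_def sum.atMost_shift sum.atLeast1_atMost_eq lessThan_Suc_atMost
        atMost_atLeast0 sum.atLeast_Suc_atMost)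
  \<comment> \<open>The ranges differ only in zero terms: \<open>xi\<close> vanishes at times after
    \<open>t\<close>, that is for \<open>l > n\<close>, and \<open>Theta_op\<close> vanishes for
    \<open>l > q\<close>.\<close>
  also have "(\<Sum>l\<in>{1..n}. xi p phi t (t - int n + int l) * Theta_op q theta l (t - int n + int l))
      = (\<Sum>l\<in>{1..q}. xi p phi t (t - int n + int l) * theta l (t - int n + int l))"
    by (rule sum.mono_neutral_cong) (auto simp: Theta_op_def xi_def)
  finally show "Xi_q_op p q phi theta n t = (Xi_op p phi \<circ>\<^sub>s Theta_op q theta) n t"
    by (simp add: Xi_q_op_def xi_q_def)
qed

section \<open>Operators acting on sequences\<close>

lemma bij_betw_diff_int: "bij_betw (\<lambda>n. t - int n) UNIV {..t}"
  by (rule bij_betw_byWitness[of _ "\<lambda>r. nat (t - r)"]) auto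

lemma summable_on_atMost_int_iff:
  fixes f :: "int \<Rightarrow> real"
  shows "(\<lambda>r. \<bar>f r\<bar>) summable_on {..t} \<longleftrightarrow> summable (\<lambda>n. \<bar>f (t - int n)\<bar>)"
  using summable_on_reindex_bij_betw[OF bij_betw_diff_int, of "\<lambda>r. \<bar>f r\<bar>" t]
  by (simp add: summable_on_UNIV_nonneg_real_iff)

lemma infsum_atMost_int: "infsum f {..t} = (\<Sum>\<^sub>\<infinity>n. f (t - int n))"
  by (rule infsum_reindex_bij_betw[OF bij_betw_diff_int, symmetric])

lemma sum_atLeastAtMost_diff_int: "(\<Sum>r\<in>{t - int n..t}. f r) = (\<Sum>i\<le>n. f (t - int i))"
  by (rule sum.reindex_bij_witness[of _ "\<lambda>i. t - int i" "\<lambda>r. nat (t - r)"]) auto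

lemma tendsto_at_bot_int_iff:
  "(f \<longlongrightarrow> l) at_bot \<longleftrightarrow> (\<lambda>n. f (t - int n)) \<longlonglongrightarrow> l"
proof
  assume "(f \<longlongrightarrow> l) at_bot"
  moreover have "filterlim (\<lambda>n. t - int n) at_bot sequentially"
    unfolding filterlim_at_bot eventually_sequentially
  proof
    fix Z
    show "\<exists>N. \<forall>n\<ge>N. t - int n \<le> Z" by (intro exI[of _ "nat (t - Z)"]) auto
  qed
  ultimately show "(\<lambda>n. f (t - int n)) \<longlonglongrightarrow> l" by (rule filterlim_compose)
next
  assume *: "(\<lambda>n. f (t - int n)) \<longlonglongrightarrow> l"
  have "filterlim (\<lambda>s. nat (t - s)) sequentially at_bot"
    unfolding filterlim_at_top eventually_at_bot_linorder
  proof
    fix Z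
    show "\<exists>N. \<forall>n\<le>N. Z \<le> nat (t - n)" by (intro exI[of _ "t - int Z"]) auto
  qed
  with * have "((\<lambda>s. f (t - int (nat (t - s)))) \<longlongrightarrow> l) at_bot" by (rule filterlim_compose)
  moreover have "eventually (\<lambda>s. f (t - int (nat (t - s))) = f s) at_bot"
    using eventually_le_at_bot[of t] by eventually_elim simp
  ultimately show "(f \<longlongrightarrow> l) at_bot" by (rule Lim_transform_eventually)
qed

text \<open>The bridge from the unordered sums by which operators act to ordered series, for which
  limits and integrals are computed.\<close>

lemma infsum_eq_suminf:
  fixes f :: "nat \<Rightarrow> real"
  assumes "summable (\<lambda>n. \<bar>f n\<bar>)"
  shows "infsum f UNIV = suminf f"
proof (rule infsumI, rule norm_summable_imp_has_sum)
  show "summable (\<lambda>n. norm (f n))" using assms by simp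
  show "f sums suminf f" using summable_rabs_cancel[OF assms] by (rule summable_sums)
qed

lemma abs_summable_on_Times_finite:
  fixes g :: "nat \<times> nat \<Rightarrow> real"
  assumes "\<And>i j. p < i \<Longrightarrow> g (i, j) = 0"
    and "\<And>i. i \<le> p \<Longrightarrow> summable (\<lambda>j. \<bar>g (i, j)\<bar>)"
  shows "(\<lambda>x. norm (g x)) summable_on UNIV \<times> UNIV"
proof -
  have "(\<lambda>x. norm (g x)) summable_on {..p} \<times> UNIV"
    unfolding Infinite_Sum.abs_summable_on_Sigma_iff
    using assms(2) by (auto simp: summable_on_UNIV_nonneg_real_iff)
  moreover have "(\<lambda>x. norm (g x)) summable_on {..p} \<times> UNIV
      \<longleftrightarrow> (\<lambda>x. norm (g x)) summable_on UNIV \<times> UNIV"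
    by (rule summable_on_cong_neutral) (auto, metis assms(1) not_le)
  ultimately show ?thesis by simp
qed

lemma abs_summable_on_swap_iff:
  fixes g :: "'a \<Rightarrow> 'b \<Rightarrow> real"
  shows "(\<lambda>(j, i). \<bar>g i j\<bar>) summable_on B \<times> A \<longleftrightarrow> (\<lambda>(i, j). \<bar>g i j\<bar>) summable_on A \<times> B"
proof -
  have "bij_betw prod.swap (B \<times> A) (A \<times> B)"
    by (rule bij_betw_byWitness[of _ prod.swap]) auto
  from summable_on_reindex_bij_betw[OF this, of "\<lambda>(i, j). \<bar>g i j\<bar>"]
  show ?thesis by (simp add: prod.swap_def case_prod_unfold)
qed

text \<open>Both sides sum one absolutely summable family over pairs of lags, the left one by rows
  and the right one along the antidiagonals \<open>i + j = n\<close>.\<close>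

lemma skew_apply_mult:
  assumes "(\<lambda>(i, j). \<bar>A i t * (C j (t - int i) * f (t - int i - int j))\<bar>)
    summable_on UNIV \<times> UNIV"
  shows "skew_apply A (skew_apply C f) t = skew_apply (A \<circ>\<^sub>s C) f t"
proof -
  define g where "g = (\<lambda>(i, j). A i t * (C j (t - int i) * f (t - int i - int j)))"
  have g: "g summable_on UNIV \<times> UNIV"
    by (rule abs_summable_summable) (use assms in \<open>simp add: g_def case_prod_unfold\<close>)
  have bij: "bij_betw (\<lambda>(n, i). (i, n - i)) (SIGMA n:UNIV. {0..n}) (UNIV \<times> (UNIV :: nat set))"
    by (rule bij_betw_byWitness[of _ "\<lambda>(i, j). (i + j, i)"]) auto
  have g': "(\<lambda>x. g ((\<lambda>(n, i). (i, n - i)) x)) summable_on (SIGMA n:UNIV. {0..n})"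
    using g by (simp add: summable_on_reindex_bij_betw[OF bij])
  have "skew_apply A (skew_apply C f) t = (\<Sum>\<^sub>\<infinity>i. \<Sum>\<^sub>\<infinity>j. g (i, j))"
    unfolding skew_apply_def g_def by (simp add: infsum_cmult_right')
  also have "\<dots> = infsum g (UNIV \<times> UNIV)"
    by (rule infsum_Sigma_banach[OF g])
  also have "\<dots> = (\<Sum>\<^sub>\<infinity>x\<in>(SIGMA n:UNIV. {0..n}). g ((\<lambda>(n, i). (i, n - i)) x))"
    by (rule infsum_reindex_bij_betw[OF bij, symmetric])
  also have "\<dots> = (\<Sum>\<^sub>\<infinity>n. \<Sum>\<^sub>\<infinity>i\<in>{0..n}. g (i, n - i))"
    using infsum_Sigma_banach[OF g'] by simp
  also have "\<dots> = skew_apply (A \<circ>\<^sub>s C) f t"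
    unfolding skew_apply_def skew_mult_def g_def sum_distrib_right
    by (intro infsum_cong) (auto simp: of_nat_diff intro!: sum.cong)
  finally show ?thesis .
qed

text \<open>The case of \<open>Phi_op\<close> acting on an infinite series: finitely many absolutely
  summable rows.\<close>

lemma skew_apply_mult_finite_left:
  assumes "\<And>i. p < i \<Longrightarrow> A i t = 0"
    and "\<And>i. summable (\<lambda>j. \<bar>C j (t - int i) * f (t - int i - int j)\<bar>)"
  shows "skew_apply A (skew_apply C f) t = skew_apply (A \<circ>\<^sub>s C) f t"
proof (rule skew_apply_mult)
  have "(\<lambda>x. norm (case x of (i, j) \<Rightarrow> A i t * (C j (t - int i) * f (t - int i - int j))))
      summable_on UNIV \<times> UNIV"
    by (rule abs_summable_on_Times_finite[where p = p])
      (use assms in \<open>auto simp: abs_mult[of "A _ _"] intro: summable_mult\<close>)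
  then show "(\<lambda>(i, j). \<bar>A i t * (C j (t - int i) * f (t - int i - int j))\<bar>)
      summable_on UNIV \<times> UNIV"
    by (simp add: case_prod_unfold)
qed

text \<open>The case of \<open>Xi_op\<close> acting after \<open>Theta_op\<close> or
  \<open>Phi_op\<close>; here the second index has finite range, so the pairs are swapped.\<close>

lemma skew_apply_mult_finite_right:
  assumes "\<And>j s. q < j \<Longrightarrow> C j s = 0"
    and "\<And>j. summable (\<lambda>i. \<bar>A i t * (C j (t - int i) * f (t - int i - int j))\<bar>)"
  shows "skew_apply A (skew_apply C f) t = skew_apply (A \<circ>\<^sub>s C) f t"
proof (rule skew_apply_mult)
  have "(\<lambda>x. norm (case x of (j, i) \<Rightarrow> A i t * (C j (t - int i) * f (t - int i - int j))))
      summable_on UNIV \<times> UNIV"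
    by (rule abs_summable_on_Times_finite[where p = q]) (use assms in auto)
  then show "(\<lambda>(i, j). \<bar>A i t * (C j (t - int i) * f (t - int i - int j))\<bar>)
      summable_on UNIV \<times> UNIV"
    by (subst abs_summable_on_swap_iff[symmetric]) (simp add: case_prod_unfold)
qed

lemma skew_apply_finite:
  assumes "\<And>i. p < i \<Longrightarrow> A i t = 0"
  shows "skew_apply A f t = (\<Sum>i\<le>p. A i t * f (t - int i))"
  unfolding skew_apply_def
  by (rule infsumI, rule has_sum_finite_neutralI[of "{..p}"]) (use assms in auto)

lemma skew_apply_one [simp]: "skew_apply skew_one f t = f t"
  by (subst skew_apply_finite[where p = 0]) (auto simp: skew_one_def skew_monom_def)

lemma skew_apply_Theta_op:
  "skew_apply (Theta_op q theta) f t = (\<Sum>l\<le>q. Theta_op q theta l t * f (t - int l))"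
  by (rule skew_apply_finite) (simp add: Theta_op_def)

lemma skew_apply_Phi_op:
  "skew_apply (Phi_op p phi) f t = f t - (\<Sum>m=1..p. phi m t * f (t - int m))"
proof -
  have "skew_apply (Phi_op p phi) f t = (\<Sum>m\<le>p. Phi_op p phi m t * f (t - int m))"
    by (rule skew_apply_finite) (simp add: Phi_op_def)
  also have "\<dots> = f t + (\<Sum>m=1..p. Phi_op p phi m t * f (t - int m))"
    by (simp add: Phi_op_def atMost_atLeast0 sum.atLeast_Suc_atMost)
  also have "(\<Sum>m=1..p. Phi_op p phi m t * f (t - int m)) = - (\<Sum>m=1..p. phi m t * f (t - int m))"
    unfolding sum_negf[symmetric] by (intro sum.cong) (auto simp: Phi_op_def)
  finally show ?thesis by simp
qed

text \<open>The identity \<open>Xi \<circ> Phi = 1\<close>, applied to \<open>y\<close> cut off at time \<open>t - n\<close>: the cut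
  changes \<open>Phi y\<close> at the times after \<open>t - n\<close> by the terms with the initial values.\<close>

lemma homogeneous_part_decomposition:
  assumes "1 \<le> p" and "0 < n"
  shows "y t \<omega> =
    (\<Sum>i<n. Xi_op p phi i t * skew_apply (Phi_op p phi) (\<lambda>s. y s \<omega>) (t - int i))
      + homogeneous_part p phi y t (t - int n) \<omega>"
proof -
  define s where "s = t - int n"
  define z where "z r = (if s < r then y r \<omega> else 0)" for r
  define \<Phi> where "\<Phi> = Phi_op p phi"
  define h where "h k m = xi p phi t (s + int k) * (phi m (s + int k) * y (s + int k - int m) \<omega>)" for k m
  \<comment> \<open>For \<open>k > n\<close> the time \<open>s + k\<close> lies after
    \<open>t\<close>, where \<open>xi\<close> is zero.\<close>
  have h0: "k \<le> n" if "h k m \<noteq> 0" for k m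
    using that by (cases "k \<le> n") (simp_all add: h_def xi_def s_def)
  \<comment> \<open>At time \<open>s\<close> and before, \<open>\<Phi>\<close> sees only values of
    \<open>z\<close> that were cut to zero.\<close>
  have tail: "skew_apply \<Phi> z (t - int i) = 0" if "n \<le> i" for i
    using that unfolding \<Phi>_def skew_apply_Phi_op by (simp add: z_def s_def)
  have "y t \<omega> = skew_apply (Xi_op p phi \<circ>\<^sub>s \<Phi>) z t"
    using \<open>0 < n\<close> by (simp add: \<Phi>_def Xi_op_mult_Phi_op[OF assms(1)] z_def s_def)
  also have "\<dots> = skew_apply (Xi_op p phi) (skew_apply \<Phi> z) t"
  proof (rule skew_apply_mult_finite_right[symmetric, where q = p])
    show "summable (\<lambda>i. \<bar>Xi_op p phi i t * (\<Phi> j (t - int i) * z (t - int i - int j))\<bar>)" for j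
      by (rule summable_finite[of "{..n}"]) (auto simp: z_def s_def)
  qed (simp add: \<Phi>_def Phi_op_def)
  also have "\<dots> = (\<Sum>i<n. Xi_op p phi i t * skew_apply \<Phi> z (t - int i))"
    unfolding skew_apply_def[of "Xi_op p phi"]
    by (rule infsumI, rule has_sum_finite_neutralI[of "{..<n}"]) (auto simp: tail)
  also have "\<dots> = (\<Sum>i<n. Xi_op p phi i t * skew_apply \<Phi> (\<lambda>s. y s \<omega>) (t - int i)
      + (\<Sum>m\<in>{n - i..p}. h (n - i) m))"
  proof (rule sum.cong)
    fix i assume i: "i \<in> {..<n}"
    \<comment> \<open>At time \<open>t - i\<close> the cut removes exactly the lags
      \<open>m \<ge> n - i\<close>, which reach back to \<open>s\<close> or earlier. They enter
      \<open>\<Phi>\<close> with a minus sign, so the cut adds them.\<close>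
    have "(\<Sum>m=1..p. phi m (t - int i) * z (t - int i - int m))
        + (\<Sum>m\<in>{n - i..p}. phi m (t - int i) * y (t - int i - int m) \<omega>)
        = (\<Sum>m=1..p. phi m (t - int i) * z (t - int i - int m))
        + (\<Sum>m=1..p. if n - i \<le> m then phi m (t - int i) * y (t - int i - int m) \<omega> else 0)"
      using i by (intro arg_cong2[where f = "(+)"] sum.mono_neutral_cong_left) auto
    also have "\<dots> = (\<Sum>m=1..p. phi m (t - int i) * y (t - int i - int m) \<omega>)"
      unfolding sum.distrib[symmetric] by (intro sum.cong) (auto simp: z_def s_def)
    finally have "skew_apply \<Phi> z (t - int i) = skew_apply \<Phi> (\<lambda>s. y s \<omega>) (t - int i)
        + (\<Sum>m\<in>{n - i..p}. phi m (t - int i) * y (t - int i - int m) \<omega>)"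
      using i unfolding \<Phi>_def skew_apply_Phi_op by (simp add: z_def s_def)
    moreover have "s + int (n - i) = t - int i" using i by (simp add: s_def of_nat_diff)
    ultimately show "Xi_op p phi i t * skew_apply \<Phi> z (t - int i)
        = Xi_op p phi i t * skew_apply \<Phi> (\<lambda>s. y s \<omega>) (t - int i)
          + (\<Sum>m\<in>{n - i..p}. h (n - i) m)"
      by (simp add: h_def Xi_op_def distrib_left sum_distrib_left)
  qed simp
  also have "\<dots> = (\<Sum>i<n. Xi_op p phi i t * skew_apply \<Phi> (\<lambda>s. y s \<omega>) (t - int i))
      + (\<Sum>i<n. \<Sum>m\<in>{n - i..p}. h (n - i) m)"
    by (rule sum.distrib)
  also have "(\<Sum>i<n. \<Sum>m\<in>{n - i..p}. h (n - i) m) = (\<Sum>k=1..n. \<Sum>m\<in>{k..p}. h k m)"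
    by (rule sum.reindex_bij_witness[of _ "\<lambda>k. n - k" "\<lambda>k. n - k"]) auto
  also have "\<dots> = (\<Sum>(k, m)\<in>(SIGMA k:{1..n}. {k..p}). h k m)"
    by (rule sum.Sigma) auto
  \<comment> \<open>Terms with \<open>k > n\<close> are zero by \<open>h0\<close>; for
    \<open>k > p\<close> the inner range is empty.\<close>
  also have "\<dots> = (\<Sum>(k, m)\<in>(SIGMA k:{1..p}. {k..p}). h k m)"
    by (rule sum.mono_neutral_cong) (auto dest: h0)
  \<comment> \<open>Grouping by initial value: lag \<open>m - 1 + r\<close> at time
    \<open>s + r\<close> reaches \<open>y (s + 1 - m)\<close>.\<close>
  also have "\<dots> = (\<Sum>(m, r)\<in>(SIGMA m:{1..p}. {1..p + 1 - m}).
      phi (m - 1 + r) (s + int r) * xi p phi t (s + int r) * y (s + 1 - int m) \<omega>)"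
    by (rule sum.reindex_bij_witness[of _ "\<lambda>(m, r). (r, m - 1 + r)" "\<lambda>(k, m). (m + 1 - k, k)"])
      (auto simp: h_def of_nat_diff algebra_simps)
  also have "\<dots> = homogeneous_part p phi y t s \<omega>"
    unfolding homogeneous_part_def sum_distrib_right by (rule sum.Sigma[symmetric]) auto
  finally show ?thesis by (simp add: \<Phi>_def s_def)
qed

section \<open>Weighted series of random variables\<close>

lemma abs_le_one_plus_square: "\<bar>x\<bar> \<le> 1 + (x :: real)\<^sup>2"
proof -
  have "0 \<le> (\<bar>x\<bar> - 1)\<^sup>2" by simp
  then have "2 * \<bar>x\<bar> \<le> 1 + x\<^sup>2" by (simp add: power2_diff)
  then show ?thesis by simp
qed

lemma weighted_cauchy_schwarz_suminf:
  fixes c e :: "nat \<Rightarrow> real"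
  assumes c: "summable (\<lambda>n. \<bar>c n\<bar>)" and e: "summable (\<lambda>n. \<bar>c n\<bar> * (e n)\<^sup>2)"
  shows "summable (\<lambda>n. \<bar>c n * e n\<bar>)"
    and "(\<Sum>n. c n * e n)\<^sup>2 \<le> (\<Sum>n. \<bar>c n\<bar>) * (\<Sum>n. \<bar>c n\<bar> * (e n)\<^sup>2)"
proof -
  have le: "\<bar>c n * e n\<bar> \<le> \<bar>c n\<bar> + \<bar>c n\<bar> * (e n)\<^sup>2" for n
  proof -
    have "\<bar>c n\<bar> * \<bar>e n\<bar> \<le> \<bar>c n\<bar> * (1 + (e n)\<^sup>2)"
      by (intro mult_left_mono abs_le_one_plus_square) auto
    then show ?thesis by (simp add: abs_mult distrib_left)
  qed
  show *: "summable (\<lambda>n. \<bar>c n * e n\<bar>)"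
  proof (rule summable_comparison_test'[OF summable_add[OF c e], of 0])
    show "norm \<bar>c n * e n\<bar> \<le> \<bar>c n\<bar> + \<bar>c n\<bar> * (e n)\<^sup>2" for n
      using le[of n] by (simp only: real_norm_def abs_idempotent)
  qed
  have "(\<lambda>N. (\<Sum>n<N. c n * e n)\<^sup>2) \<longlonglongrightarrow> (\<Sum>n. c n * e n)\<^sup>2"
    by (intro tendsto_power summable_LIMSEQ summable_rabs_cancel[OF *])
  moreover have "(\<lambda>N. (\<Sum>n<N. \<bar>c n\<bar>) * (\<Sum>n<N. \<bar>c n\<bar> * (e n)\<^sup>2))
      \<longlonglongrightarrow> (\<Sum>n. \<bar>c n\<bar>) * (\<Sum>n. \<bar>c n\<bar> * (e n)\<^sup>2)"
    by (intro tendsto_mult summable_LIMSEQ c e)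
  moreover have "(\<Sum>n<N. c n * e n)\<^sup>2 \<le> (\<Sum>n<N. \<bar>c n\<bar>) * (\<Sum>n<N. \<bar>c n\<bar> * (e n)\<^sup>2)" for N
  proof -
    \<comment> \<open>Half of each weight goes to either factor, so that the squares of both factors
      carry the weight \<open>\<bar>c n\<bar>\<close>.\<close>
    have "(sgn (c n) * sqrt \<bar>c n\<bar>) * (sqrt \<bar>c n\<bar> * e n) = c n * e n" for n
    proof -
      have "(sgn (c n) * sqrt \<bar>c n\<bar>) * (sqrt \<bar>c n\<bar> * e n)
          = sgn (c n) * (sqrt \<bar>c n\<bar> * sqrt \<bar>c n\<bar>) * e n" by (simp only: ac_simps)
      then show ?thesis by (simp add: sgn_mult_abs)
    qed
    then have "(\<Sum>n<N. c n * e n)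
        = (\<Sum>n<N. (sgn (c n) * sqrt \<bar>c n\<bar>) * (sqrt \<bar>c n\<bar> * e n))"
      by (simp only:)
    also have "\<dots>\<^sup>2 \<le> (\<Sum>n<N. (sgn (c n) * sqrt \<bar>c n\<bar>)\<^sup>2) * (\<Sum>n<N. (sqrt \<bar>c n\<bar> * e n)\<^sup>2)"
      by (rule Cauchy_Schwarz_ineq_sum)
    also have "(\<Sum>n<N. (sgn (c n) * sqrt \<bar>c n\<bar>)\<^sup>2) = (\<Sum>n<N. \<bar>c n\<bar>)"
      by (intro sum.cong) (auto simp: power_mult_distrib sgn_if)
    also have "(\<Sum>n<N. (sqrt \<bar>c n\<bar> * e n)\<^sup>2) = (\<Sum>n<N. \<bar>c n\<bar> * (e n)\<^sup>2)"
      by (simp add: power_mult_distrib)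
    finally show ?thesis .
  qed
  ultimately show "(\<Sum>n. c n * e n)\<^sup>2 \<le> (\<Sum>n. \<bar>c n\<bar>) * (\<Sum>n. \<bar>c n\<bar> * (e n)\<^sup>2)"
    by (intro LIMSEQ_le[where X = "\<lambda>N. (\<Sum>n<N. c n * e n)\<^sup>2"]) auto
qed

section \<open>Almost sure convergence and moments of weighted series\<close>

context prob_space
begin

context
  fixes c :: "nat \<Rightarrow> real" and e :: "nat \<Rightarrow> 'a \<Rightarrow> real" and C :: real
  assumes c: "summable (\<lambda>n. \<bar>c n\<bar>)"
    and e_measurable [measurable]: "\<And>n. e n \<in> borel_measurable M"
    and e_square_integrable: "\<And>n. integrable M (\<lambda>\<omega>. (e n \<omega>)\<^sup>2)"
    and e_second_moment: "\<And>n. expectation (\<lambda>\<omega>. (e n \<omega>)\<^sup>2) \<le> C"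
begin

lemma nn_integral_weighted_squares:
  "(\<integral>\<^sup>+\<omega>. (\<Sum>n. ennreal (\<bar>c n\<bar> * (e n \<omega>)\<^sup>2)) \<partial>M) \<le> ennreal (C * (\<Sum>n. \<bar>c n\<bar>))"
proof -
  have "(\<integral>\<^sup>+\<omega>. (\<Sum>n. ennreal (\<bar>c n\<bar> * (e n \<omega>)\<^sup>2)) \<partial>M)
      = (\<Sum>n. \<integral>\<^sup>+\<omega>. ennreal (\<bar>c n\<bar> * (e n \<omega>)\<^sup>2) \<partial>M)"
    by (rule nn_integral_suminf) measurable
  also have "\<dots> = (\<Sum>n. ennreal (\<bar>c n\<bar> * expectation (\<lambda>\<omega>. (e n \<omega>)\<^sup>2)))"
    by (subst nn_integral_eq_integral) (auto simp: e_square_integrable)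
  also have "\<dots> \<le> (\<Sum>n. ennreal (\<bar>c n\<bar> * C))"
    by (intro suminf_le ennreal_leI mult_left_mono e_second_moment) auto
  also have "\<dots> = ennreal (\<Sum>n. \<bar>c n\<bar> * C)"
  proof (rule suminf_ennreal_eq)
    have "0 \<le> C" using e_second_moment[of 0] by (rule order_trans[rotated]) simp
    then show "0 \<le> \<bar>c n\<bar> * C" for n by simp
    show "(\<lambda>n. \<bar>c n\<bar> * C) sums (\<Sum>n. \<bar>c n\<bar> * C)"
      by (intro summable_sums summable_mult2 c)
  qed
  also have "(\<Sum>n. \<bar>c n\<bar> * C) = C * (\<Sum>n. \<bar>c n\<bar>)"
    using suminf_mult2[OF c, of C] by (simp add: mult.commute)
  finally show ?thesis .
qed

text \<open>A nonnegative function with finite integral is finite almost everywhere.\<close>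

lemma AE_summable_weighted_squares: "AE \<omega> in M. summable (\<lambda>n. \<bar>c n\<bar> * (e n \<omega>)\<^sup>2)"
proof -
  have "(\<integral>\<^sup>+\<omega>. (\<Sum>n. ennreal (\<bar>c n\<bar> * (e n \<omega>)\<^sup>2)) \<partial>M) < \<infinity>"
    by (rule le_less_trans[OF nn_integral_weighted_squares]) simp
  then have "AE \<omega> in M. (\<Sum>n. ennreal (\<bar>c n\<bar> * (e n \<omega>)\<^sup>2)) \<noteq> \<infinity>"
    by (intro nn_integral_PInf_AE less_imp_neq) measurable
  then show ?thesis
    by eventually_elim (rule summable_suminf_not_top, simp_all)
qed

lemma AE_summable_weighted: "AE \<omega> in M. summable (\<lambda>n. \<bar>c n * e n \<omega>\<bar>)"
  using AE_summable_weighted_squares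
  by eventually_elim (rule weighted_cauchy_schwarz_suminf(1)[OF c])

lemma nn_integral_square_suminf_le:
  "(\<integral>\<^sup>+\<omega>. ennreal ((\<Sum>n. c n * e n \<omega>)\<^sup>2) \<partial>M) \<le> ennreal (C * (\<Sum>n. \<bar>c n\<bar>)\<^sup>2)"
proof -
  let ?S = "\<Sum>n. \<bar>c n\<bar>"
  have S: "0 \<le> ?S" by (intro suminf_nonneg c) simp
  have "(\<integral>\<^sup>+\<omega>. ennreal ((\<Sum>n. c n * e n \<omega>)\<^sup>2) \<partial>M)
      \<le> (\<integral>\<^sup>+\<omega>. ennreal ?S * (\<Sum>n. ennreal (\<bar>c n\<bar> * (e n \<omega>)\<^sup>2)) \<partial>M)"
  proof (rule nn_integral_mono_AE)
    show "AE \<omega> in M. ennreal ((\<Sum>n. c n * e n \<omega>)\<^sup>2)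
        \<le> ennreal ?S * (\<Sum>n. ennreal (\<bar>c n\<bar> * (e n \<omega>)\<^sup>2))"
      using AE_summable_weighted_squares
    proof eventually_elim
      fix \<omega> assume \<omega>: "summable (\<lambda>n. \<bar>c n\<bar> * (e n \<omega>)\<^sup>2)"
      have "(\<Sum>n. ennreal (\<bar>c n\<bar> * (e n \<omega>)\<^sup>2)) = ennreal (\<Sum>n. \<bar>c n\<bar> * (e n \<omega>)\<^sup>2)"
        by (rule suminf_ennreal_eq) (auto simp: \<omega> summable_sums)
      then show "ennreal ((\<Sum>n. c n * e n \<omega>)\<^sup>2)
          \<le> ennreal ?S * (\<Sum>n. ennreal (\<bar>c n\<bar> * (e n \<omega>)\<^sup>2))"
        using weighted_cauchy_schwarz_suminf(2)[OF c \<omega>] S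
        by (simp add: ennreal_mult'[symmetric] ennreal_leI)
    qed
  qed
  also have "\<dots> = ennreal ?S * (\<integral>\<^sup>+\<omega>. (\<Sum>n. ennreal (\<bar>c n\<bar> * (e n \<omega>)\<^sup>2)) \<partial>M)"
    by (rule nn_integral_cmult) measurable
  also have "\<dots> \<le> ennreal ?S * ennreal (C * ?S)"
    by (intro mult_left_mono nn_integral_weighted_squares) auto
  also have "\<dots> = ennreal (C * ?S\<^sup>2)"
    using S by (simp add: ennreal_mult'[symmetric] power2_eq_square algebra_simps)
  finally show ?thesis .
qed

text \<open>The bound \<open>1 + C\<close> on the first absolute moments makes the sum of the L1
  norms finite, which justifies integrating term by term.\<close>

lemma
  assumes e_mean: "\<And>n. expectation (e n) = 0"
  shows integrable_weighted_suminf: "integrable M (\<lambda>\<omega>. \<Sum>n. c n * e n \<omega>)"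
    and expectation_weighted_suminf: "expectation (\<lambda>\<omega>. \<Sum>n. c n * e n \<omega>) = 0"
proof -
  have e_int: "integrable M (e n)" for n
    by (rule square_integrable_imp_integrable) (use e_square_integrable in auto)
  have int: "integrable M (\<lambda>\<omega>. c n * e n \<omega>)" for n using e_int by simp
  have AE: "AE \<omega> in M. summable (\<lambda>n. norm (c n * e n \<omega>))"
    using AE_summable_weighted by simp
  have abs_le: "expectation (\<lambda>\<omega>. \<bar>e n \<omega>\<bar>) \<le> 1 + C" for n
  proof -
    have "expectation (\<lambda>\<omega>. \<bar>e n \<omega>\<bar>) \<le> expectation (\<lambda>\<omega>. 1 + (e n \<omega>)\<^sup>2)"
      using e_int e_square_integrable by (intro integral_mono abs_le_one_plus_square) auto
    also have "\<dots> \<le> 1 + C"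
      using e_square_integrable e_second_moment[of n] by (simp add: prob_space)
    finally show ?thesis .
  qed
  have sum: "summable (\<lambda>n. expectation (\<lambda>\<omega>. norm (c n * e n \<omega>)))"
  proof (rule summable_comparison_test'[OF summable_mult2[OF c, of "1 + C"]])
    show "norm (expectation (\<lambda>\<omega>. norm (c n * e n \<omega>))) \<le> \<bar>c n\<bar> * (1 + C)" for n
      using mult_left_mono[OF abs_le, of "\<bar>c n\<bar>" n] by (simp add: abs_mult)
  qed
  show "integrable M (\<lambda>\<omega>. \<Sum>n. c n * e n \<omega>)"
    by (rule integrable_suminf[OF int AE sum])
  show "expectation (\<lambda>\<omega>. \<Sum>n. c n * e n \<omega>) = 0"
    by (subst integral_suminf[OF int AE sum]) (simp add: e_mean)
qed

end

section \<open>Almost sure limits and limits in probability\<close>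

lemma AE_LIMSEQ_imp_LIMSEQ_prob:
  fixes X :: "nat \<Rightarrow> 'a \<Rightarrow> real"
  assumes X [measurable]: "\<And>n. X n \<in> borel_measurable M"
    and AE: "AE \<omega> in M. (\<lambda>n. X n \<omega>) \<longlonglongrightarrow> 0" and "0 < e"
  shows "(\<lambda>n. prob {\<omega> \<in> space M. e < \<bar>X n \<omega>\<bar>}) \<longlonglongrightarrow> 0"
proof -
  have "(\<lambda>n. expectation (indicator {\<omega> \<in> space M. e < \<bar>X n \<omega>\<bar>} :: _ \<Rightarrow> real))
      \<longlonglongrightarrow> expectation (\<lambda>_. 0 :: real)"
  proof (rule integral_dominated_convergence[where w = "\<lambda>_. 1"])
    show "AE \<omega> in M. (\<lambda>n. indicator {\<omega> \<in> space M. e < \<bar>X n \<omega>\<bar>} \<omega> :: real) \<longlonglongrightarrow> 0"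
      using AE
    proof eventually_elim
      fix \<omega> assume "(\<lambda>n. X n \<omega>) \<longlonglongrightarrow> 0"
      then have "\<forall>\<^sub>F n in sequentially. \<bar>X n \<omega>\<bar> < e"
        using \<open>0 < e\<close> by (simp add: tendsto_iff)
      then have "\<forall>\<^sub>F n in sequentially. (indicator {\<omega> \<in> space M. e < \<bar>X n \<omega>\<bar>} \<omega> :: real) = 0"
        by eventually_elim simp
      then show "(\<lambda>n. indicator {\<omega> \<in> space M. e < \<bar>X n \<omega>\<bar>} \<omega> :: real) \<longlonglongrightarrow> 0"
        by (rule tendsto_eventually)
    qed
  qed (auto simp: indicator_def)
  then show ?thesis by simp
qed

text \<open>Uniqueness of limits in probability: \<open>2 * e < \<bar>D \<omega>\<bar>\<close>
  forces \<open>e < \<bar>X n \<omega>\<bar>\<close> or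
  \<open>e < \<bar>X n \<omega> - D \<omega>\<bar>\<close>.\<close>

lemma AE_limit_eq_0_iff_LIMSEQ_prob:
  fixes X :: "nat \<Rightarrow> 'a \<Rightarrow> real"
  assumes X [measurable]: "\<And>n. X n \<in> borel_measurable M" and D [measurable]: "D \<in> borel_measurable M"
    and AE: "AE \<omega> in M. (\<lambda>n. X n \<omega>) \<longlonglongrightarrow> D \<omega>"
  shows "(AE \<omega> in M. D \<omega> = 0) \<longleftrightarrow> (\<forall>e>0. (\<lambda>n. prob {\<omega> \<in> space M. e < \<bar>X n \<omega>\<bar>}) \<longlonglongrightarrow> 0)"
proof
  assume "AE \<omega> in M. D \<omega> = 0"
  with AE have "AE \<omega> in M. (\<lambda>n. X n \<omega>) \<longlonglongrightarrow> 0" by eventually_elim simp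
  then show "\<forall>e>0. (\<lambda>n. prob {\<omega> \<in> space M. e < \<bar>X n \<omega>\<bar>}) \<longlonglongrightarrow> 0"
    by (intro allI impI AE_LIMSEQ_imp_LIMSEQ_prob) auto
next
  assume X0: "\<forall>e>0. (\<lambda>n. prob {\<omega> \<in> space M. e < \<bar>X n \<omega>\<bar>}) \<longlonglongrightarrow> 0"
  have "AE \<omega> in M. \<bar>D \<omega>\<bar> \<le> 2 * e" if "0 < e" for e
  proof -
    let ?P = "\<lambda>n. prob {\<omega> \<in> space M. e < \<bar>X n \<omega>\<bar>}"
    let ?Q = "\<lambda>n. prob {\<omega> \<in> space M. e < \<bar>X n \<omega> - D \<omega>\<bar>}"
    have "AE \<omega> in M. (\<lambda>n. X n \<omega> - D \<omega>) \<longlonglongrightarrow> 0"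
      using AE by eventually_elim (simp add: LIM_zero_iff)
    then have "?Q \<longlonglongrightarrow> 0"
      using \<open>0 < e\<close> by (intro AE_LIMSEQ_imp_LIMSEQ_prob) auto
    then have lim: "(\<lambda>n. ?P n + ?Q n) \<longlonglongrightarrow> 0"
      using X0 \<open>0 < e\<close> tendsto_add[of ?P 0 sequentially ?Q 0] by simp
    have "prob {\<omega> \<in> space M. 2 * e < \<bar>D \<omega>\<bar>} \<le> ?P n + ?Q n" for n
    proof -
      have "prob {\<omega> \<in> space M. 2 * e < \<bar>D \<omega>\<bar>}
          \<le> prob ({\<omega> \<in> space M. e < \<bar>X n \<omega>\<bar>} \<union> {\<omega> \<in> space M. e < \<bar>X n \<omega> - D \<omega>\<bar>})"
        by (rule finite_measure_mono) auto
      also have "\<dots> \<le> ?P n + ?Q n" by (rule measure_Un_le) auto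
      finally show ?thesis .
    qed
    then have "prob {\<omega> \<in> space M. 2 * e < \<bar>D \<omega>\<bar>} \<le> 0"
      by (intro LIMSEQ_le_const[OF lim]) auto
    then have "prob {\<omega> \<in> space M. 2 * e < \<bar>D \<omega>\<bar>} = 0" by (simp add: measure_le_0_iff)
    then have "AE \<omega> in M. \<not> 2 * e < \<bar>D \<omega>\<bar>" by (subst prob_Collect_eq_0[symmetric]) auto
    then show ?thesis by eventually_elim simp
  qed
  \<comment> \<open>Countably many thresholds suffice, so the quantifier may move inside the almost
    sure statement.\<close>
  then have "AE \<omega> in M. \<forall>k. \<bar>D \<omega>\<bar> \<le> 2 * inverse (real (Suc k))"
    unfolding AE_all_countable by simp
  then show "AE \<omega> in M. D \<omega> = 0"
  proof eventually_elim
    fix \<omega> assume le: "\<forall>k. \<bar>D \<omega>\<bar> \<le> 2 * inverse (real (Suc k))"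
    have lim: "(\<lambda>k. 2 * inverse (real (Suc k))) \<longlonglongrightarrow> 0"
      using tendsto_mult[OF tendsto_const LIMSEQ_inverse_real_of_nat, of 2] by simp
    have "\<bar>D \<omega>\<bar> \<le> 0" by (rule LIMSEQ_le_const[OF lim]) (use le in blast)
    then show "D \<omega> = 0" by simp
  qed
qed

end

section \<open>The decomposition\<close>

lemma summable_mult_bounded:
  fixes a b :: "nat \<Rightarrow> real"
  assumes "summable (\<lambda>n. \<bar>a n\<bar>)" and b: "\<And>n. \<bar>b n\<bar> \<le> C"
  shows "summable (\<lambda>n. \<bar>a n * b n\<bar>)"
proof (rule summable_comparison_test'[OF summable_mult2[OF assms(1), of C], of 0])
  show "norm \<bar>a n * b n\<bar> \<le> \<bar>a n\<bar> * C" for n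
    using mult_left_mono[OF b[of n], of "\<bar>a n\<bar>"] by (simp add: abs_mult)
qed

text \<open>This holds without any convergence: both sides are the same unordered sum, indexed by
  time and by lag.\<close>

lemma wold_cramer_stoch_eq:
  "wold_cramer_stoch p q phi theta eps t \<omega> = skew_apply (Xi_q_op p q phi theta) (\<lambda>s. eps s \<omega>) t"
  by (simp add: wold_cramer_stoch_def infsum_atMost_int skew_apply_def Xi_q_op_def)

lemma wold_cramer_eq:
  "wold_cramer p q varphi phi theta eps t \<omega> =
    skew_apply (Xi_op p phi) varphi t + skew_apply (Xi_q_op p q phi theta) (\<lambda>s. eps s \<omega>) t"
  by (simp add: wold_cramer_def wold_cramer_det_def wold_cramer_stoch_eq infsum_atMost_int
      skew_apply_def Xi_op_def)

section \<open>Absolute summability and the model equation\<close>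

context tv_arma
begin

context
  assumes summ: "\<And>t. (\<lambda>r. \<bar>xi p phi t r\<bar>) summable_on {..t}"
    and varphi_bounded: "bounded (range varphi)"
    and theta_bounded: "\<forall>l\<in>{1..q}. bounded (range (theta l))"
begin

lemma summable_Xi_op: "summable (\<lambda>n. \<bar>Xi_op p phi n t\<bar>)"
  using summ[of t] unfolding summable_on_atMost_int_iff by (simp add: Xi_op_def)

lemma summable_Xi_op_varphi: "summable (\<lambda>n. \<bar>Xi_op p phi n t * varphi (t - int n)\<bar>)"
proof -
  obtain C where "\<And>r. \<bar>varphi r\<bar> \<le> C" using varphi_bounded by (auto simp: bounded_iff)
  then show ?thesis by (intro summable_mult_bounded[OF summable_Xi_op])
qed

lemma summable_Xi_op_Theta_op:
  "summable (\<lambda>n. \<bar>Xi_op p phi n t * Theta_op q theta l (t - int n)\<bar>)"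
proof -
  have "\<exists>C. \<forall>r. \<bar>Theta_op q theta l r\<bar> \<le> C"
  proof (cases "l \<in> {1..q}")
    case True
    then show ?thesis using bspec[OF theta_bounded True] by (auto simp: bounded_iff Theta_op_def)
  next
    case False
    then show ?thesis by (intro exI[of _ 1]) (auto simp: Theta_op_def)
  qed
  then obtain C where "\<And>r. \<bar>Theta_op q theta l r\<bar> \<le> C" by blast
  then show ?thesis by (intro summable_mult_bounded[OF summable_Xi_op])
qed

text \<open>The coefficients are a sum of \<open>q + 1\<close> sequences; \<open>h l\<close> is the
  absolutely summable sequence of \<open>Xi_op\<close> times the \<open>l\<close>-th moving average
  coefficient, delayed by \<open>l\<close>.\<close>

lemma summable_Xi_q_op: "summable (\<lambda>n. \<bar>Xi_q_op p q phi theta n t\<bar>)"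
proof -
  define h where "h l n =
    (if l \<le> n then Xi_op p phi (n - l) t * Theta_op q theta l (t - int (n - l)) else 0)" for l n
  have Xi_q: "Xi_q_op p q phi theta n t = (\<Sum>l\<le>q. h l n)" for n
  proof -
    have "Xi_q_op p q phi theta n t
        = (\<Sum>l\<le>n. Xi_op p phi (n - l) t * Theta_op q theta l (t - int (n - l)))"
      unfolding Xi_q_op_eq skew_mult_def
      by (rule sum.reindex_bij_witness[of _ "\<lambda>i. n - i" "\<lambda>i. n - i"]) auto
    also have "\<dots> = (\<Sum>l\<le>q. h l n)"
      by (rule sum.mono_neutral_cong) (auto simp: h_def Theta_op_def)
    finally show ?thesis .
  qed
  have "summable (\<lambda>n. \<bar>h l n\<bar>)" for l
  proof (rule summable_offset)
    show "summable (\<lambda>n. \<bar>h l (n + l)\<bar>)"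
      using summable_Xi_op_Theta_op[of t l] by (simp add: h_def)
  qed
  then have "summable (\<lambda>n. \<Sum>l\<le>q. \<bar>h l n\<bar>)" by (intro summable_sum)
  then show ?thesis
    by (rule summable_comparison_test'[of _ 0]) (simp add: Xi_q sum_abs)
qed

lemma eps_second_moment_bounded: "\<exists>C. \<forall>t. expectation (\<lambda>\<omega>. (eps t \<omega>)\<^sup>2) \<le> C"
  using sigma2_bounded by (simp add: eps_variance)

lemma AE_summable_eps:
  assumes "summable (\<lambda>n. \<bar>c n\<bar>)"
  shows "AE \<omega> in M. summable (\<lambda>n. \<bar>c n * eps (k n) \<omega>\<bar>)"
proof -
  obtain C where "\<And>t. expectation (\<lambda>\<omega>. (eps t \<omega>)\<^sup>2) \<le> C"
    using eps_second_moment_bounded by blast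
  then show ?thesis
    by (intro AE_summable_weighted[OF assms] eps_measurable eps_square_integrable)
qed

text \<open>Times and lags are countable, so one null set serves them all.\<close>

lemma AE_summable_Xi_op_Theta_op_eps:
  "AE \<omega> in M. \<forall>t l. summable (\<lambda>n. \<bar>Xi_op p phi n t
      * (Theta_op q theta l (t - int n) * eps (t - int n - int l) \<omega>)\<bar>)"
  unfolding AE_all_countable mult.assoc[symmetric]
  by (intro allI AE_summable_eps summable_Xi_op_Theta_op)

lemma AE_summable_Xi_q_op_eps:
  "AE \<omega> in M. \<forall>t. summable (\<lambda>n. \<bar>Xi_q_op p q phi theta n t * eps (t - int n) \<omega>\<bar>)"
  unfolding AE_all_countable by (intro allI AE_summable_eps summable_Xi_q_op)

text \<open>The ordered series is the version whose measurability and integral are treated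
  below.\<close>

lemma AE_skew_apply_Xi_q_op_eq_suminf:
  "AE \<omega> in M. skew_apply (Xi_q_op p q phi theta) (\<lambda>s. eps s \<omega>) t
     = (\<Sum>n. Xi_q_op p q phi theta n t * eps (t - int n) \<omega>)"
  using AE_summable_Xi_q_op_eps
  by eventually_elim (simp add: skew_apply_def infsum_eq_suminf)

text \<open>The error at \<open>s = t - n\<close> is almost surely the tail of the series from lag
  \<open>Suc n\<close> on. Its second moment is at most \<open>C\<close> times the square of the
  tail of the absolute coefficients.\<close>

lemma wold_cramer_stoch_mean_square:
  "((\<lambda>s. \<integral>\<^sup>+ \<omega>. ennreal ((wold_cramer_stoch p q phi theta eps t \<omega>
      - (\<Sum>r\<in>{s..t}. xi_q p q phi theta t r * eps r \<omega>))\<^sup>2) \<partial>M) \<longlongrightarrow> 0) at_bot"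
proof -
  define c where "c n = Xi_q_op p q phi theta n t" for n
  have c: "summable (\<lambda>n. \<bar>c n\<bar>)" unfolding c_def by (rule summable_Xi_q_op)
  obtain C where C: "\<And>t. expectation (\<lambda>\<omega>. (eps t \<omega>)\<^sup>2) \<le> C"
    using eps_second_moment_bounded by blast
  define I where "I s = (\<integral>\<^sup>+ \<omega>. ennreal ((wold_cramer_stoch p q phi theta eps t \<omega>
      - (\<Sum>r\<in>{s..t}. xi_q p q phi theta t r * eps r \<omega>))\<^sup>2) \<partial>M)" for s
  have le: "I (t - int n) \<le> ennreal (C * (\<Sum>i. \<bar>c (i + Suc n)\<bar>)\<^sup>2)" for n
  proof -
    have "I (t - int n)
        = (\<integral>\<^sup>+ \<omega>. ennreal ((\<Sum>i. c (i + Suc n) * eps (t - int (i + Suc n)) \<omega>)\<^sup>2) \<partial>M)"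
      unfolding I_def
    proof (rule nn_integral_cong_AE)
      show "AE \<omega> in M. ennreal ((wold_cramer_stoch p q phi theta eps t \<omega>
            - (\<Sum>r\<in>{t - int n..t}. xi_q p q phi theta t r * eps r \<omega>))\<^sup>2)
          = ennreal ((\<Sum>i. c (i + Suc n) * eps (t - int (i + Suc n)) \<omega>)\<^sup>2)"
        using AE_summable_Xi_q_op_eps AE_skew_apply_Xi_q_op_eq_suminf[of t]
      proof eventually_elim
        case (elim \<omega>)
        then have "summable (\<lambda>n. c n * eps (t - int n) \<omega>)"
          unfolding c_def by (blast intro: summable_rabs_cancel)
        from suminf_split_initial_segment[OF this, of "Suc n"] elim
        show ?case
          by (simp add: wold_cramer_stoch_eq sum_atLeastAtMost_diff_int c_def Xi_q_op_def
              lessThan_Suc_atMost del: of_nat_Suc sum.lessThan_Suc)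
      qed
    qed
    also have "\<dots> \<le> ennreal (C * (\<Sum>i. \<bar>c (i + Suc n)\<bar>)\<^sup>2)"
      by (intro nn_integral_square_suminf_le eps_measurable eps_square_integrable C)
        (use c in \<open>simp only: summable_iff_shift[of "\<lambda>n. \<bar>c n\<bar>"]\<close>)
    finally show ?thesis .
  qed
  have "(\<lambda>n. C * (\<Sum>i. \<bar>c (i + n)\<bar>)\<^sup>2) \<longlonglongrightarrow> C * 0\<^sup>2"
    by (intro tendsto_intros suminf_exist_split2 c)
  then have "(\<lambda>n. C * (\<Sum>i. \<bar>c (i + Suc n)\<bar>)\<^sup>2) \<longlonglongrightarrow> 0"
    by (intro LIMSEQ_Suc) simp
  then have "(\<lambda>n. ennreal (C * (\<Sum>i. \<bar>c (i + Suc n)\<bar>)\<^sup>2)) \<longlonglongrightarrow> ennreal 0"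
    by (rule tendsto_ennrealI)
  then have lim: "(\<lambda>n. ennreal (C * (\<Sum>i. \<bar>c (i + Suc n)\<bar>)\<^sup>2)) \<longlonglongrightarrow> 0" by simp
  have "(\<lambda>n. I (t - int n)) \<longlonglongrightarrow> 0"
    by (rule tendsto_sandwich[OF _ _ tendsto_const lim])
      (intro always_eventually allI le zero_le)+
  then have "(I \<longlongrightarrow> 0) at_bot" by (simp add: tendsto_at_bot_int_iff[of _ _ t])
  then show ?thesis by (simp add: I_def[abs_def])
qed

text \<open>Associativity reduces the claim to \<open>Phi_op\<close> times \<open>Xi_op\<close>
  being one and \<open>Phi_op\<close> times \<open>Xi_q_op\<close> being \<open>Theta_op\<close>.
  Convergence must hold at all lagged times simultaneously.\<close>

lemma AE_wold_cramer_solution: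
  "AE \<omega> in M. skew_apply (Phi_op p phi) (\<lambda>s. wold_cramer p q varphi phi theta eps s \<omega>) t
     = varphi t + skew_apply (Theta_op q theta) (\<lambda>s. eps s \<omega>) t"
  using AE_summable_Xi_q_op_eps
proof eventually_elim
  case (elim \<omega>)
  let ?\<Phi> = "Phi_op p phi" and ?\<Xi> = "Xi_op p phi" and ?\<Xi>q = "Xi_q_op p q phi theta"
  have "skew_apply ?\<Phi> (\<lambda>s. wold_cramer p q varphi phi theta eps s \<omega>) t
      = skew_apply ?\<Phi> (skew_apply ?\<Xi> varphi) t
        + skew_apply ?\<Phi> (skew_apply ?\<Xi>q (\<lambda>s. eps s \<omega>)) t"
    unfolding skew_apply_Phi_op wold_cramer_eq by (simp add: distrib_left sum.distrib)
  also have "skew_apply ?\<Phi> (skew_apply ?\<Xi> varphi) t = skew_apply (?\<Phi> \<circ>\<^sub>s ?\<Xi>) varphi t"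
    by (rule skew_apply_mult_finite_left[where p = p])
      (auto simp: Phi_op_def summable_Xi_op_varphi)
  also have "\<dots> = varphi t" by (simp add: Phi_op_mult_Xi_op[OF p_ge_1])
  also have "skew_apply ?\<Phi> (skew_apply ?\<Xi>q (\<lambda>s. eps s \<omega>)) t
      = skew_apply (?\<Phi> \<circ>\<^sub>s ?\<Xi>q) (\<lambda>s. eps s \<omega>) t"
    by (rule skew_apply_mult_finite_left[where p = p])
      (use elim in \<open>auto simp: Phi_op_def\<close>)
  also have "?\<Phi> \<circ>\<^sub>s ?\<Xi>q = Theta_op q theta"
    by (simp add: Xi_q_op_eq Phi_op_mult_Xi_op[OF p_ge_1] flip: skew_mult_assoc)
  finally show ?case .
qed

lemma AE_homogeneous_part_tendsto:
  "AE \<omega> in M. (\<lambda>n. homogeneous_part p phi y t (t - int (Suc n)) \<omega>)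
     \<longlonglongrightarrow> y t \<omega> - wold_cramer p q varphi phi theta eps t \<omega>"
proof -
  have "AE \<omega> in M. \<forall>t. skew_apply (Phi_op p phi) (\<lambda>s. y s \<omega>) t
      = varphi t + skew_apply (Theta_op q theta) (\<lambda>s. eps s \<omega>) t"
    unfolding AE_all_countable using model by blast
  then show ?thesis
    using AE_summable_Xi_op_Theta_op_eps
  proof eventually_elim
    case (elim \<omega>)
    let ?\<Xi> = "Xi_op p phi" and ?\<Theta> = "Theta_op q theta" and ?e = "\<lambda>s. eps s \<omega>"
    define v where "v n = ?\<Xi> n t * varphi (t - int n)" for n
    define w where "w n = ?\<Xi> n t * skew_apply ?\<Theta> ?e (t - int n)" for n
    have v: "summable (\<lambda>n. \<bar>v n\<bar>)" unfolding v_def by (rule summable_Xi_op_varphi)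
    have w_eq: "w n = (\<Sum>l\<le>q. ?\<Xi> n t * (?\<Theta> l (t - int n) * ?e (t - int n - int l)))" for n
      by (simp add: w_def skew_apply_Theta_op sum_distrib_left)
    have "summable (\<lambda>n. \<Sum>l\<le>q. \<bar>?\<Xi> n t * (?\<Theta> l (t - int n) * ?e (t - int n - int l))\<bar>)"
      by (intro summable_sum) (use elim in blast)
    then have w: "summable (\<lambda>n. \<bar>w n\<bar>)"
      by (rule summable_comparison_test'[of _ 0]) (simp add: w_eq sum_abs)
    have "suminf v = skew_apply ?\<Xi> varphi t"
      using infsum_eq_suminf[OF v] by (simp add: skew_apply_def v_def[abs_def])
    moreover have "suminf w = skew_apply ?\<Xi> (skew_apply ?\<Theta> ?e) t"
      using infsum_eq_suminf[OF w] by (simp add: skew_apply_def[of ?\<Xi>] w_def[abs_def])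
    \<comment> \<open>The model groups the errors as \<open>\<Theta>\<close> first and
      \<open>\<Xi>\<close> second; associativity regroups the limit as the action of
      \<open>Xi_q_op\<close>.\<close>
    moreover have "skew_apply ?\<Xi> (skew_apply ?\<Theta> ?e) t = skew_apply (?\<Xi> \<circ>\<^sub>s ?\<Theta>) ?e t"
      by (rule skew_apply_mult_finite_right[where q = q])
        (use elim in \<open>auto simp: Theta_op_def\<close>)
    ultimately have wold: "wold_cramer p q varphi phi theta eps t \<omega> = suminf v + suminf w"
      by (simp add: wold_cramer_eq Xi_q_op_eq)
    \<comment> \<open>\<open>Suc n\<close> keeps the number of steps positive, as
      \<open>homogeneous_part_decomposition\<close> demands.\<close>
    have hom: "homogeneous_part p phi y t (t - int (Suc n)) \<omega>
        = y t \<omega> - ((\<Sum>i<Suc n. v i) + (\<Sum>i<Suc n. w i))" for n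
    proof -
      have "y t \<omega> = (\<Sum>i<Suc n. ?\<Xi> i t * skew_apply (Phi_op p phi) (\<lambda>s. y s \<omega>) (t - int i))
          + homogeneous_part p phi y t (t - int (Suc n)) \<omega>"
        by (rule homogeneous_part_decomposition[OF p_ge_1]) simp
      also have "(\<Sum>i<Suc n. ?\<Xi> i t * skew_apply (Phi_op p phi) (\<lambda>s. y s \<omega>) (t - int i))
          = (\<Sum>i<Suc n. v i) + (\<Sum>i<Suc n. w i)"
        using elim by (simp add: v_def w_def distrib_left sum.distrib del: sum.lessThan_Suc)
      finally show ?thesis by simp
    qed
    have "(\<lambda>n. (\<Sum>i<n. v i) + (\<Sum>i<n. w i)) \<longlonglongrightarrow> suminf v + suminf w"
      by (intro tendsto_add summable_LIMSEQ summable_rabs_cancel[OF v] summable_rabs_cancel[OF w])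
    from LIMSEQ_Suc[OF this] show ?case
      unfolding hom wold by (intro tendsto_diff tendsto_const)
  qed
qed

lemma AE_wold_cramer_iff_homogeneous_part_vanishes:
  "(AE \<omega> in M. y t \<omega> = wold_cramer p q varphi phi theta eps t \<omega>) \<longleftrightarrow>
     (\<forall>e>0. ((\<lambda>s. measure M {\<omega> \<in> space M. e < \<bar>homogeneous_part p phi y t s \<omega>\<bar>})
        \<longlongrightarrow> 0) at_bot)"
proof -
  note [measurable] = y_measurable eps_measurable
  \<comment> \<open>A measurable version of \<open>y t\<close> minus the decomposition, with the
    ordered series in place of the unordered sum.\<close>
  define D where "D \<omega> = y t \<omega> - (skew_apply (Xi_op p phi) varphi t
      + (\<Sum>n. Xi_q_op p q phi theta n t * eps (t - int n) \<omega>))" for \<omega>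
  have D [measurable]: "D \<in> borel_measurable M" unfolding D_def by measurable
  have D_eq: "AE \<omega> in M. D \<omega> = y t \<omega> - wold_cramer p q varphi phi theta eps t \<omega>"
    using AE_skew_apply_Xi_q_op_eq_suminf[of t]
    by eventually_elim (simp add: D_def wold_cramer_eq)
  have X: "homogeneous_part p phi y t s \<in> borel_measurable M" for s
    unfolding homogeneous_part_def by measurable
  have lim: "AE \<omega> in M. (\<lambda>n. homogeneous_part p phi y t (t - int (Suc n)) \<omega>) \<longlonglongrightarrow> D \<omega>"
    using AE_homogeneous_part_tendsto[of t] D_eq by eventually_elim simp
  have "(AE \<omega> in M. y t \<omega> = wold_cramer p q varphi phi theta eps t \<omega>) \<longleftrightarrow> (AE \<omega> in M. D \<omega> = 0)"
    by (rule eventually_subst) (use D_eq in \<open>eventually_elim, simp\<close>)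
  also have "\<dots> \<longleftrightarrow> (\<forall>e>0. (\<lambda>n. prob {\<omega> \<in> space M.
      e < \<bar>homogeneous_part p phi y t (t - int (Suc n)) \<omega>\<bar>}) \<longlonglongrightarrow> 0)"
    by (rule AE_limit_eq_0_iff_LIMSEQ_prob[OF X D lim])
  also have "\<dots> \<longleftrightarrow> (\<forall>e>0. ((\<lambda>s. prob {\<omega> \<in> space M.
      e < \<bar>homogeneous_part p phi y t s \<omega>\<bar>}) \<longlongrightarrow> 0) at_bot)"
    unfolding tendsto_at_bot_int_iff[of _ _ t]
    using filterlim_sequentially_Suc[of "\<lambda>n. prob {\<omega> \<in> space M.
      e < \<bar>homogeneous_part p phi y t (t - int n) \<omega>\<bar>}" for e]
    by (simp only:)
  finally show ?thesis .
qed

text \<open>Almost surely \<open>y t\<close> is a constant plus the integrable series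
  \<open>S\<close> of mean zero.\<close>

lemma
  assumes y: "AE \<omega> in M. y t \<omega> = wold_cramer p q varphi phi theta eps t \<omega>"
  shows integrable_wold_cramer_solution: "integrable M (y t)"
    and expectation_wold_cramer_solution: "expectation (y t) = skew_apply (Xi_op p phi) varphi t"
proof -
  note [measurable] = y_measurable eps_measurable
  define S where "S \<omega> = (\<Sum>n. Xi_q_op p q phi theta n t * eps (t - int n) \<omega>)" for \<omega>
  obtain C where C: "\<And>t. expectation (\<lambda>\<omega>. (eps t \<omega>)\<^sup>2) \<le> C"
    using eps_second_moment_bounded by blast
  have S: "integrable M S" "expectation S = 0"
    unfolding S_def
    by (intro integrable_weighted_suminf[where C = C] expectation_weighted_suminf[where C = C]
        summable_Xi_q_op eps_measurable eps_square_integrable C eps_mean)+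
  have AE: "AE \<omega> in M. y t \<omega> = skew_apply (Xi_op p phi) varphi t + S \<omega>"
    using y AE_skew_apply_Xi_q_op_eq_suminf[of t]
    by eventually_elim (simp add: S_def wold_cramer_eq)
  have [measurable]: "S \<in> borel_measurable M" using S(1) by simp
  show "integrable M (y t)"
    by (subst integrable_cong_AE[OF _ _ AE]) (use S in auto)
  have "expectation (y t) = expectation (\<lambda>\<omega>. skew_apply (Xi_op p phi) varphi t + S \<omega>)"
    by (rule integral_cong_AE[OF _ _ AE]) auto
  then show "expectation (y t) = skew_apply (Xi_op p phi) varphi t"
    using S by (simp add: prob_space)
qed

end

end

text \<open>Adding a deterministic homogeneous solution to \<open>y\<close> changes neither the
  errors nor the past sigma algebras, so the model alone does not force the decomposition. For the
  given \<open>y\<close> it is therefore characterised by an equivalence, and the mean is derived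
  from it.\<close>

theorem theorem11:
  fixes M :: "'w measure"
    and p q :: nat
    and varphi :: "int \<Rightarrow> real"
    and phi theta :: "nat \<Rightarrow> int \<Rightarrow> real"
    and sigma2 :: "int \<Rightarrow> real"
    and eps y :: "int \<Rightarrow> 'w \<Rightarrow> real"
  assumes model: "tv_arma M p q varphi phi theta sigma2 eps y"
    and summ: "\<And>t. (\<lambda>r. \<bar>xi p phi t r\<bar>) summable_on {..t}"
  shows
    \<comment> \<open>the Wold-Cramer operators\<close>
    "(Xi_op p phi \<circ>\<^sub>s Phi_op p phi = skew_one
      \<and> Phi_op p phi \<circ>\<^sub>s Xi_op p phi = skew_one
      \<and> Xi_op p phi = skew_inverse (Phi_op p phi)
      \<and> Xi_q_op p q phi theta = skew_inverse (Phi_op p phi) \<circ>\<^sub>s Theta_op q theta)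
   \<and> (bounded (range varphi) \<and> (\<forall>l\<in>{1..q}. bounded (range (theta l))) \<longrightarrow>
      \<comment> \<open>convergence of the series: absolute, almost sure, and in mean square\<close>
      (\<forall>t. (\<lambda>r. \<bar>xi p phi t r * varphi r\<bar>) summable_on {..t})
    \<and> (\<forall>t. AE \<omega> in M. (\<lambda>r. \<bar>xi_q p q phi theta t r * eps r \<omega>\<bar>) summable_on {..t})
    \<and> (\<forall>t. ((\<lambda>s. \<integral>\<^sup>+ \<omega>. ennreal ((wold_cramer_stoch p q phi theta eps t \<omega>
               - (\<Sum>r\<in>{s..t}. xi_q p q phi theta t r * eps r \<omega>))\<^sup>2) \<partial>M) \<longlongrightarrow> 0) at_bot)
      \<comment> \<open>the decomposition defines a solution of the model equation\<close>
    \<and> (\<forall>t. AE \<omega> in M.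
          skew_apply (Phi_op p phi) (\<lambda>s. wold_cramer p q varphi phi theta eps s \<omega>) t
            = varphi t + skew_apply (Theta_op q theta) (\<lambda>s. eps s \<omega>) t)
      \<comment> \<open>the given solution has the decomposition iff its homogeneous part vanishes in the limit\<close>
    \<and> (\<forall>t. (AE \<omega> in M. y t \<omega> = wold_cramer p q varphi phi theta eps t \<omega>) \<longleftrightarrow>
          (\<forall>e>0. ((\<lambda>s. measure M {\<omega> \<in> space M. e < \<bar>homogeneous_part p phi y t s \<omega>\<bar>})
                    \<longlongrightarrow> 0) at_bot))
      \<comment> \<open>operator form of the decomposition, and the mean\<close>
    \<and> (\<forall>t. (AE \<omega> in M. y t \<omega> = wold_cramer p q varphi phi theta eps t \<omega>) \<longrightarrow>
          (AE \<omega> in M. y t \<omega> = skew_apply (Xi_op p phi) varphi t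
                               + skew_apply (Xi_q_op p q phi theta) (\<lambda>s. eps s \<omega>) t)
        \<and> integrable M (y t)
        \<and> (LINT \<omega>|M. y t \<omega>) = skew_apply (Xi_op p phi) varphi t))"
proof -
  interpret tv_arma M p q varphi phi theta sigma2 eps y by (rule model)
  have inverse: "skew_inverse (Phi_op p phi) = Xi_op p phi"
    by (intro skew_inverse_eqI Phi_op_mult_Xi_op Xi_op_mult_Phi_op p_ge_1)
  show ?thesis
  proof (intro conjI impI allI)
    assume "bounded (range varphi) \<and> (\<forall>l\<in>{1..q}. bounded (range (theta l)))"
    then have b: "bounded (range varphi)" "\<forall>l\<in>{1..q}. bounded (range (theta l))" by auto
    note bounds = summ b
    show "(\<lambda>r. \<bar>xi p phi t r * varphi r\<bar>) summable_on {..t}" for t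
      using summable_Xi_op_varphi[OF bounds, of t]
      unfolding summable_on_atMost_int_iff by (simp add: Xi_op_def)
    show "AE \<omega> in M. (\<lambda>r. \<bar>xi_q p q phi theta t r * eps r \<omega>\<bar>) summable_on {..t}" for t
      using AE_summable_Xi_q_op_eps[OF bounds]
      unfolding summable_on_atMost_int_iff by eventually_elim (simp add: Xi_q_op_def)
    show "AE \<omega> in M. y t \<omega> = skew_apply (Xi_op p phi) varphi t
        + skew_apply (Xi_q_op p q phi theta) (\<lambda>s. eps s \<omega>) t"
      if "AE \<omega> in M. y t \<omega> = wold_cramer p q varphi phi theta eps t \<omega>" for t
      using that by (simp add: wold_cramer_eq)
    show "((\<lambda>s. \<integral>\<^sup>+ \<omega>. ennreal ((wold_cramer_stoch p q phi theta eps t \<omega>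
        - (\<Sum>r\<in>{s..t}. xi_q p q phi theta t r * eps r \<omega>))\<^sup>2) \<partial>M) \<longlongrightarrow> 0) at_bot" for t
      by (rule wold_cramer_stoch_mean_square[OF bounds])
    show "AE \<omega> in M. skew_apply (Phi_op p phi) (\<lambda>s. wold_cramer p q varphi phi theta eps s \<omega>) t
        = varphi t + skew_apply (Theta_op q theta) (\<lambda>s. eps s \<omega>) t" for t
      by (rule AE_wold_cramer_solution[OF bounds])
    show "(AE \<omega> in M. y t \<omega> = wold_cramer p q varphi phi theta eps t \<omega>) \<longleftrightarrow>
        (\<forall>e>0. ((\<lambda>s. measure M {\<omega> \<in> space M. e < \<bar>homogeneous_part p phi y t s \<omega>\<bar>})
          \<longlongrightarrow> 0) at_bot)" for t
      by (rule AE_wold_cramer_iff_homogeneous_part_vanishes[OF bounds])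
    show "integrable M (y t)"
      if "AE \<omega> in M. y t \<omega> = wold_cramer p q varphi phi theta eps t \<omega>" for t
      by (rule integrable_wold_cramer_solution[OF bounds that])
    show "(LINT \<omega>|M. y t \<omega>) = skew_apply (Xi_op p phi) varphi t"
      if "AE \<omega> in M. y t \<omega> = wold_cramer p q varphi phi theta eps t \<omega>" for t
      by (rule expectation_wold_cramer_solution[OF bounds that])
  \<comment> \<open>The remaining goals are the four operator identities.\<close>
  qed (simp_all add: inverse Phi_op_mult_Xi_op[OF p_ge_1] Xi_op_mult_Phi_op[OF p_ge_1]
      Xi_q_op_eq)
qed

end
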